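(* Let $V_1,\ldots,V_m$ be a collection of $m\ge n$ subsemimodules of $\mathbf{R}_{\max,\mathrm{m}}^n$. If each $n$ of these semimodules intersect nontrivially (i.e. their intersection contains a nonzero vector), then the whole collection has a nontrivial intersection, i.e. $V_1\cap\cdots\cap V_m\neq\{0\}$.
   Context: $\mathbf{R}_{\max,\mathrm{m}}$ is the max-times semiring: the set $\mathbf{R}_+$ of nonnegative reals with addition $a\oplus b=\max(a,b)$ and the usual multiplication. $\mathbf{R}_{\max,\mathrm{m}}^n$ is $\mathbf{R}_+^n$ ($n\ge1$) with entrywise $\oplus$ and scalar multiplication. A subsemimodule is a subset containing $0$ and closed under $\oplus$ and under multiplication by scalars from $\mathbf{R}_+$. No topological closedness is assumed. *)

theory Defs
  imports "HOL-Analysis.Analysis"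
begin

text \<open>
  The max-times semimodule of dimension \<open>n = CARD('n)\<close> is represented by the set of
  vectors of type \<^typ>\<open>real ^ 'n\<close> with nonnegative entries; its scalars are the
  nonnegative reals, acting by the usual scalar multiplication.
\<close>

definition maxtimes_space :: "(real ^ 'n) set" where
  "maxtimes_space = {x. \<forall>i. 0 \<le> x $ i}"

definition vmax :: "real ^ 'n \<Rightarrow> real ^ 'n \<Rightarrow> real ^ 'n" where
  "vmax x y = (\<chi> i. max (x $ i) (y $ i))"

definition subsemimodule :: "(real ^ 'n) set \<Rightarrow> bool" where
  "subsemimodule V \<longleftrightarrow>
     V \<subseteq> maxtimes_space \<and>
     0 \<in> V \<and>
     (\<forall>x\<in>V. \<forall>y\<in>V. vmax x y \<in> V) \<and>
     (\<forall>c\<ge>0. \<forall>x\<in>V. c *\<^sub>R x \<in> V)"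

end

theory Submission
  imports Defs
begin

text \<open>
  The argument is the tropical analogue of Radon's proof of Helly's theorem. Any more than
  \<open>n\<close> vectors in the max-times semimodule of dimension \<open>n\<close> admit two
  nontrivial max-combinations with disjoint supports and the same value: for each \<open>p\<close>, the
  entrywise \<open>p\<close>-th powers of the vectors are linearly dependent over the reals; taking
  \<open>p\<close>-th roots of the coefficients and passing to a limit \<open>p \<rightarrow> \<infinity>\<close>
  turns sums into maxima. Applied to nonzero vectors \<open>x k\<close> lying in all \<open>V i\<close>
  with \<open>i \<noteq> k\<close>, which exist by induction on the number of semimodules, the common
  value lies in every \<open>V i\<close>, since one of the two supports avoids \<open>i\<close>.
\<close>

text \<open>A vector with coefficient 0 contributes the zero vector, which lies in \<open>V\<close>
  anyway. So only vectors in the support have to belong to \<open>V\<close>, and a combination may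
  include vectors outside \<open>V\<close>.\<close>

lemma vmax_Max_closed:
  assumes V: "subsemimodule V" and K: "finite K" "K \<noteq> {}"
    and x: "\<And>i. i \<in> K \<Longrightarrow> c i \<ge> (0::real)" "\<And>i. i \<in> K \<Longrightarrow> c i \<noteq> 0 \<Longrightarrow> x i \<in> V"
  shows "(\<chi> j. Max ((\<lambda>i. c i * x i $ j) ` K)) \<in> V"
  using K x
proof (induction K rule: finite_ne_induct)
  case (singleton i)
  have "c i *\<^sub>R x i \<in> V"
    using V singleton by (cases "c i = 0") (auto simp: subsemimodule_def)
  moreover have "(\<chi> j. Max ((\<lambda>i. c i * x i $ j) ` {i})) = c i *\<^sub>R x i"
    by (simp add: vec_eq_iff)
  ultimately show ?case by metis
next
  case (insert i K)
  have "c i *\<^sub>R x i \<in> V"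
    using V insert.prems by (cases "c i = 0") (auto simp: subsemimodule_def)
  moreover have "(\<chi> j. Max ((\<lambda>i. c i * x i $ j) ` K)) \<in> V"
    using insert by simp
  moreover have "(\<chi> j. Max ((\<lambda>i. c i * x i $ j) ` insert i K))
      = vmax (c i *\<^sub>R x i) (\<chi> j. Max ((\<lambda>i. c i * x i $ j) ` K))"
    using insert.hyps by (simp add: vec_eq_iff vmax_def)
  ultimately show ?case using V by (auto simp: subsemimodule_def)
qed

lemma tendsto_Max_image:
  fixes f :: "'a \<Rightarrow> 'b \<Rightarrow> real"
  assumes "finite K" "K \<noteq> {}" "\<And>i. i \<in> K \<Longrightarrow> (f i \<longlongrightarrow> l i) F"
  shows "((\<lambda>k. Max ((\<lambda>i. f i k) ` K)) \<longlongrightarrow> Max (l ` K)) F"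
  using assms
  by (induction K rule: finite_ne_induct) (auto intro!: tendsto_max)

text \<open>Dependence is needed for an indexed family, in which repeated vectors count separately.
  A repetition gives the relation with coefficients 1 and -1; an injective family reduces to its
  image set.\<close>

lemma linear_dependence_family:
  fixes y :: "'a \<Rightarrow> 'b::euclidean_space"
  assumes "finite K" "DIM('b) < card K"
  obtains u where "\<exists>i\<in>K. u i \<noteq> 0" "(\<Sum>i\<in>K. u i *\<^sub>R y i) = 0"
proof (cases "inj_on y K")
  case True
  then have "dependent (y ` K)"
    using assms by (intro dependent_biggerset) (auto simp: card_image)
  then obtain w where w: "\<exists>v\<in>y ` K. w v \<noteq> 0" "(\<Sum>v\<in>y ` K. w v *\<^sub>R v) = 0"
    using assms by (auto simp: dependent_finite)
  then show ?thesis
    using that[of "w \<circ> y"] True by (auto simp: sum.reindex)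
next
  case False
  then obtain i j where ij: "i \<in> K" "j \<in> K" "i \<noteq> j" "y i = y j"
    by (auto simp: inj_on_def)
  define u where "u l = (if l = i then 1 else if l = j then -1 else (0::real))" for l
  have "(\<Sum>l\<in>K. u l *\<^sub>R y l) = (\<Sum>l\<in>{i, j}. u l *\<^sub>R y l)"
    using ij assms by (intro sum.mono_neutral_right) (auto simp: u_def)
  also have "\<dots> = 0"
    using ij by (simp add: u_def)
  finally show ?thesis
    using that[of u] ij(1) by (force simp: u_def)
qed

text \<open>Bolzano-Weierstrass is applied to one index after another; each refinement preserves the
  convergence already obtained.\<close>

lemma simultaneous_convergent_subseq:
  fixes f :: "'a \<Rightarrow> nat \<Rightarrow> real"
  assumes "finite K" "\<And>i k. i \<in> K \<Longrightarrow> \<bar>f i k\<bar> \<le> B"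
  obtains r l where "strict_mono r" "\<And>i. i \<in> K \<Longrightarrow> (\<lambda>k. f i (r k)) \<longlonglongrightarrow> l i"
proof -
  have "\<exists>r. strict_mono r \<and> (\<forall>i\<in>K. convergent (f i \<circ> r))"
    using assms
  proof (induction K rule: finite_induct)
    case empty
    then show ?case using strict_mono_id by blast
  next
    case (insert i K)
    obtain r where r: "strict_mono r" "\<forall>i\<in>K. convergent (f i \<circ> r)"
      using insert.IH insert.prems by blast
    have "bounded (range (f i \<circ> r))"
      using insert.prems by (intro boundedI[of _ B]) auto
    then obtain L s where s: "strict_mono s" "((f i \<circ> r) \<circ> s) \<longlonglongrightarrow> L"
      using bounded_imp_convergent_subsequence by blast
    have "convergent (f j \<circ> (r \<circ> s))" if "j \<in> insert i K" for j
    proof (cases "j = i")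
      case True
      then show ?thesis using s by (auto simp: convergent_def o_assoc)
    next
      case False
      then show ?thesis
        using that r s convergent_subseq_convergent[of "f j \<circ> r" s] by (simp add: o_assoc)
    qed
    then show ?case using r s strict_mono_o by blast
  qed
  then obtain r where "strict_mono r" "\<And>i. i \<in> K \<Longrightarrow> \<exists>l. (\<lambda>k. f i (r k)) \<longlonglongrightarrow> l"
    by (auto simp: convergent_def o_def)
  then show ?thesis using that by metis
qed

text \<open>A sum of p-th powers lies between the p-th power of its largest base and
  \<open>card K\<close> times that power. Equal sums thus force equal maxima up to a factor that
  tends to 1 as p grows.\<close>

lemma Max_le_root_card_times_Max:
  fixes a b :: "'a \<Rightarrow> real"
  assumes K: "finite K" "K \<noteq> {}" and p: "p > 0"
    and nonneg: "\<And>i. i \<in> K \<Longrightarrow> 0 \<le> a i" "\<And>i. i \<in> K \<Longrightarrow> 0 \<le> b i"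
    and eq: "(\<Sum>i\<in>K. a i ^ p) = (\<Sum>i\<in>K. b i ^ p)"
  shows "Max (a ` K) \<le> root p (card K) * Max (b ` K)"
proof -
  define M where "M = Max (b ` K)"
  have bM: "b i \<le> M" if "i \<in> K" for i
    using K that by (auto simp: M_def)
  then have M: "0 \<le> M" using K nonneg by (metis all_not_in_conv order_trans)
  have "a i \<le> root p (card K) * M" if i: "i \<in> K" for i
  proof -
    have "a i ^ p \<le> (\<Sum>i\<in>K. a i ^ p)"
      using K i nonneg by (intro member_le_sum) auto
    also have "\<dots> \<le> (\<Sum>i\<in>K. M ^ p)"
      unfolding eq using bM nonneg by (intro sum_mono power_mono) auto
    also have "\<dots> = (root p (card K) * M) ^ p"
      using p by (simp add: power_mult_distrib)
    finally show ?thesis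
      using M p by (meson mult_nonneg_nonneg of_nat_0_le_iff power_mono_iff real_root_ge_zero
          nonneg(1) i)
  qed
  then show ?thesis using K by (auto simp: M_def)
qed

text \<open>For p > 0, even or odd, \<open>root p\<close> preserves signs, so it commutes with
  taking the positive part.\<close>

lemma power_max_root:
  assumes "p > 0"
  shows "max (root p u) 0 ^ p = max u 0"
  using assms by (cases "u \<ge> 0") (auto simp: max_def zero_power)

text \<open>The positive and negative parts of a single signed family \<open>\<mu>\<close> encode
  two combinations with disjoint supports.\<close>

theorem maxtimes_radon:
  fixes x :: "'a \<Rightarrow> real ^ 'n"
  assumes K: "finite K" "CARD('n) < card K"
    and x: "\<And>i. i \<in> K \<Longrightarrow> x i \<in> maxtimes_space"
  obtains \<mu> where "\<exists>i\<in>K. \<mu> i \<noteq> 0"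
    "\<And>j. Max ((\<lambda>i. max (\<mu> i) 0 * x i $ j) ` K) = Max ((\<lambda>i. max (- \<mu> i) 0 * x i $ j) ` K)"
proof -
  have ne: "K \<noteq> {}" using K by auto
  have nonneg: "0 \<le> x i $ j" if "i \<in> K" for i j
    using x[OF that] by (simp add: maxtimes_space_def)
  \<comment> \<open>Scaling the largest absolute coefficient to 1 gives the bound needed for
    compactness and keeps the limit from vanishing.\<close>
  have "\<exists>u. (\<exists>i\<in>K. \<bar>u i\<bar> = 1) \<and> (\<forall>i\<in>K. \<bar>u i\<bar> \<le> 1) \<and>
      (\<forall>j. (\<Sum>i\<in>K. u i * (x i $ j) ^ p) = 0)" for p
  proof -
    obtain w where w: "\<exists>i\<in>K. w i \<noteq> 0" "(\<Sum>i\<in>K. w i *\<^sub>R (\<chi> j. (x i $ j) ^ p)) = (0 :: real ^ 'n)"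
      using linear_dependence_family[OF K(1), of "\<lambda>i. (\<chi> j. (x i $ j) ^ p) :: real ^ 'n"] K(2)
      by auto
    define M where "M = Max ((\<lambda>i. \<bar>w i\<bar>) ` K)"
    have le: "\<bar>w i\<bar> \<le> M" if "i \<in> K" for i
      using K that by (auto simp: M_def)
    then have M: "M > 0" using w(1) by force
    have "M \<in> (\<lambda>i. \<bar>w i\<bar>) ` K"
      unfolding M_def using K ne by (intro Max_in) auto
    then have "\<exists>i\<in>K. \<bar>w i / M\<bar> = 1"
      using M by auto
    moreover have "\<forall>i\<in>K. \<bar>w i / M\<bar> \<le> 1"
      using M le by auto
    moreover have "(\<Sum>i\<in>K. w i / M * (x i $ j) ^ p) = 0" for j
    proof -
      have "(\<Sum>i\<in>K. w i * (x i $ j) ^ p) = 0"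
        using arg_cong[OF w(2), of "\<lambda>v. v $ j"] by simp
      then show ?thesis
        by (simp flip: sum_divide_distrib)
    qed
    ultimately show ?thesis
      by (intro exI[of _ "\<lambda>i. w i / M"]) auto
  qed
  then obtain u where u: "\<And>p. \<exists>i\<in>K. \<bar>u p i\<bar> = 1" "\<And>p i. i \<in> K \<Longrightarrow> \<bar>u p i\<bar> \<le> 1"
    "\<And>p j. (\<Sum>i\<in>K. u p i * (x i $ j) ^ p) = (0::real)"
    by metis
  \<comment> \<open>\<^term>\<open>root\<close> is odd, so the limits retain the signs of the coefficients.\<close>
  define f where "f i k = root (Suc k) (u (Suc k) i)" for i k
  have f1: "\<bar>f i k\<bar> \<le> 1" if "i \<in> K" for i k
    using u(2)[OF that] by (simp add: f_def flip: real_root_abs)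
  obtain r \<mu> where r: "strict_mono r" and \<mu>: "\<And>i. i \<in> K \<Longrightarrow> (\<lambda>k. f i (r k)) \<longlonglongrightarrow> \<mu> i"
    using simultaneous_convergent_subseq[of K f 1, OF K(1) f1] by blast
  \<comment> \<open>The index with absolute value 1 may change with \<open>k\<close>. The sum of all
    absolute values is at least 1 for every \<open>k\<close>, and this bound survives the
    limit.\<close>
  have nontriv: "\<exists>i\<in>K. \<mu> i \<noteq> 0"
  proof (rule ccontr)
    assume "\<not> ?thesis"
    then have "(\<lambda>k. \<Sum>i\<in>K. \<bar>f i (r k)\<bar>) \<longlonglongrightarrow> (\<Sum>i\<in>K. \<bar>0\<bar>)"
      using \<mu> by (intro tendsto_sum tendsto_rabs) auto
    moreover have "1 \<le> (\<Sum>i\<in>K. \<bar>f i k\<bar>)" for k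
    proof -
      obtain i where i: "i \<in> K" "\<bar>u (Suc k) i\<bar> = 1" using u(1) by blast
      then have "\<bar>f i k\<bar> = 1" by (simp add: f_def flip: real_root_abs)
      then show ?thesis
        using member_le_sum[of i K "\<lambda>i. \<bar>f i k\<bar>"] i K by simp
    qed
    ultimately have "1 \<le> (\<Sum>i\<in>K. \<bar>0::real\<bar>)"
      by (intro LIMSEQ_le_const) auto
    then show False by simp
  qed
  \<comment> \<open>The linear relation is split by sign, with the negative terms moved to the other
    side.\<close>
  have sums_eq: "(\<Sum>i\<in>K. (max (f i k) 0 * x i $ j) ^ Suc k)
      = (\<Sum>i\<in>K. (max (- f i k) 0 * x i $ j) ^ Suc k)" for j k
  proof -
    have "(max (f i k) 0 * x i $ j) ^ Suc k - (max (- f i k) 0 * x i $ j) ^ Suc k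
        = u (Suc k) i * (x i $ j) ^ Suc k" for i
    proof -
      have "max (f i k) 0 ^ Suc k - max (- f i k) 0 ^ Suc k = u (Suc k) i"
        unfolding f_def real_root_minus[symmetric] power_max_root[OF zero_less_Suc] by auto
      then show ?thesis
        unfolding power_mult_distrib left_diff_distrib[symmetric] by simp
    qed
    then have "(\<Sum>i\<in>K. (max (f i k) 0 * x i $ j) ^ Suc k)
        - (\<Sum>i\<in>K. (max (- f i k) 0 * x i $ j) ^ Suc k) = 0"
      using u(3)[of "Suc k" j] by (simp only: flip: sum_subtractf)
    then show ?thesis by simp
  qed
  \<comment> \<open>The sign \<open>s\<close> exchanges the two sides, so one argument yields both
    inequalities.\<close>
  have limit_le: "Max ((\<lambda>i. max (s * \<mu> i) 0 * x i $ j) ` K)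
      \<le> Max ((\<lambda>i. max (- (s * \<mu> i)) 0 * x i $ j) ` K)" if s: "s = 1 \<or> s = -1" for s j
  proof -
    have step: "Max ((\<lambda>i. max (s * f i k) 0 * x i $ j) ` K)
      \<le> root (Suc k) (card K) * Max ((\<lambda>i. max (- (s * f i k)) 0 * x i $ j) ` K)" for k
      using s sums_eq[of k j] nonneg
      by (intro Max_le_root_card_times_Max K ne) auto
    have lim: "(\<lambda>k. Max ((\<lambda>i. max (t * f i (r k)) 0 * x i $ j) ` K))
        \<longlonglongrightarrow> Max ((\<lambda>i. max (t * \<mu> i) 0 * x i $ j) ` K)" for t
      by (intro tendsto_Max_image K ne tendsto_intros tendsto_max \<mu>)
    have "(\<lambda>k. root (Suc (r k)) (card K)) \<longlonglongrightarrow> 1"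
      using LIMSEQ_subseq_LIMSEQ[OF LIMSEQ_Suc[OF LIMSEQ_root_const[of "card K"]] r] K
      by (simp add: o_def)
    from tendsto_mult[OF this lim[of "- s"]]
    have "(\<lambda>k. root (Suc (r k)) (card K) * Max ((\<lambda>i. max (- (s * f i (r k))) 0 * x i $ j) ` K))
      \<longlonglongrightarrow> Max ((\<lambda>i. max (- (s * \<mu> i)) 0 * x i $ j) ` K)"
      by simp
    then show ?thesis
      using LIMSEQ_le[OF lim[of s]] step by blast
  qed
  show ?thesis
    using that[OF nontriv] limit_le[of 1] limit_le[of "-1"] by (simp add: order_antisym)
qed

text \<open>Arbitrary finite index sets let the induction remove any one index;
  \<open>card I = CARD('n)\<close> is the base case.\<close>

lemma maxtimes_helly:
  fixes V :: "'a \<Rightarrow> (real ^ 'n) set"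
  assumes "finite I" "CARD('n) \<le> card I"
    and "\<And>i. i \<in> I \<Longrightarrow> subsemimodule (V i)"
    and "\<And>J. J \<subseteq> I \<Longrightarrow> card J = CARD('n) \<Longrightarrow> \<exists>x\<in>(\<Inter>j\<in>J. V j). x \<noteq> 0"
  shows "\<exists>x\<in>(\<Inter>i\<in>I. V i). x \<noteq> 0"
  using assms
proof (induction I rule: finite_psubset_induct)
  case (psubset I)
  show ?case
  proof (cases "card I = CARD('n)")
    case True
    then show ?thesis using psubset.prems(3) by blast
  next
    case False
    then have card: "CARD('n) < card I" using psubset.prems(1) by simp
    have "\<exists>x. x \<in> (\<Inter>i\<in>I - {p}. V i) \<and> x \<noteq> 0" if "p \<in> I" for p
    proof -
      have "\<exists>x\<in>(\<Inter>i\<in>I - {p}. V i). x \<noteq> 0"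
      proof (rule psubset.IH)
        show "CARD('n) \<le> card (I - {p})"
          using that card psubset.hyps by simp
        show "\<exists>x\<in>(\<Inter>j\<in>J. V j). x \<noteq> 0" if "J \<subseteq> I - {p}" "card J = CARD('n)" for J
          by (rule psubset.prems) (use that in auto)
      qed (use that psubset.prems(2) in auto)
      then show ?thesis by blast
    qed
    then obtain x where x': "\<And>p. p \<in> I \<Longrightarrow> x p \<in> (\<Inter>i\<in>I - {p}. V i)"
      and x0: "\<And>p. p \<in> I \<Longrightarrow> x p \<noteq> 0"
      by metis
    have x: "x p \<in> V i" if "p \<in> I" "i \<in> I" "i \<noteq> p" for p i
      using x'[OF that(1)] that by blast
    have xnn: "x p \<in> maxtimes_space" if "p \<in> I" for p
    proof -
      \<comment> \<open>Nonnegativity of \<open>x p\<close> must come from some \<open>V i\<close>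
        with \<open>i \<noteq> p\<close>; such an \<open>i\<close> exists because
        \<open>card I > CARD('n) \<ge> 1\<close>.\<close>
      have "\<not> I \<subseteq> {p}"
        using card_mono[of "{p}" I] card zero_less_card_finite[where 'a = 'n] by auto
      then obtain i where "i \<in> I" "i \<noteq> p" by blast
      then show ?thesis
        using x[OF that] psubset.prems(2) unfolding subsemimodule_def by blast
    qed
    obtain \<mu> where \<mu>: "\<exists>i\<in>I. \<mu> i \<noteq> 0"
      "\<And>j. Max ((\<lambda>i. max (\<mu> i) 0 * x i $ j) ` I) = Max ((\<lambda>i. max (- \<mu> i) 0 * x i $ j) ` I)"
      using maxtimes_radon[of I x, OF psubset.hyps card xnn] by blast
    define z :: "real ^ 'n" where "z = (\<chi> j. Max ((\<lambda>i. max (\<mu> i) 0 * x i $ j) ` I))"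
    have z': "z = (\<chi> j. Max ((\<lambda>i. max (- \<mu> i) 0 * x i $ j) ` I))"
      by (simp add: z_def \<mu>(2))
    have ne: "I \<noteq> {}" using \<mu>(1) by blast
    have "z \<in> V p" if p: "p \<in> I" for p
    \<comment> \<open>The expression for \<open>z\<close> is chosen so that \<open>p\<close> is
      outside its support; every vector it really uses then lies in \<open>V p\<close>.\<close>
    proof (cases "\<mu> p > 0")
      case True
      show ?thesis
        unfolding z' using True p psubset.hyps ne
        by (intro vmax_Max_closed[OF psubset.prems(2)]) (auto simp: max_def intro!: x split: if_splits)
    next
      case False
      show ?thesis
        unfolding z_def using False p psubset.hyps ne
        by (intro vmax_Max_closed[OF psubset.prems(2)]) (auto simp: max_def intro!: x split: if_splits)
    qed
    moreover have "z \<noteq> 0"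
    proof -
      obtain i where i: "i \<in> I" "\<mu> i \<noteq> 0" using \<mu>(1) by blast
      obtain j where j: "x i $ j \<noteq> 0" using x0[OF i(1)] by (auto simp: vec_eq_iff)
      then have pos: "x i $ j > 0"
        using xnn[OF i(1)] by (simp add: maxtimes_space_def less_le)
      \<comment> \<open>Both expressions for \<open>z\<close> bound the entry from below, so the
        sign of \<open>\<mu> i\<close> does not matter.\<close>
      have "max (\<mu> i) 0 * x i $ j \<le> z $ j"
        using i psubset.hyps by (auto simp: z_def)
      moreover have "max (- \<mu> i) 0 * x i $ j \<le> z $ j"
        using i psubset.hyps by (auto simp: z')
      ultimately have "\<bar>\<mu> i\<bar> * x i $ j \<le> z $ j"
        by (auto simp: max_def abs_if split: if_splits)
      then have "z $ j > 0"
        using i(2) pos by (smt (verit) mult_pos_pos zero_less_abs_iff)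
      then show ?thesis by auto
    qed
    ultimately show ?thesis by blast
  qed
qed

theorem theorem24:
  fixes V :: "nat \<Rightarrow> (real ^ 'n) set" and m :: nat
  assumes "CARD('n) \<le> m"
    and "\<And>i. i \<in> {1..m} \<Longrightarrow> subsemimodule (V i)"
    and "\<And>J. J \<subseteq> {1..m} \<Longrightarrow> card J = CARD('n) \<Longrightarrow> \<exists>x\<in>(\<Inter>j\<in>J. V j). x \<noteq> 0"
  shows "(\<Inter>i\<in>{1..m}. V i) \<noteq> {0}"
proof -
  have "\<exists>x\<in>(\<Inter>i\<in>{1..m}. V i). x \<noteq> 0"
    by (rule maxtimes_helly) (use assms in auto)
  then show ?thesis by blast
qed

end
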